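(* Let $k$ be a field of characteristic zero, let $n\ge 1$, and let $\phi:=(f_1,\dots,f_n)$ be a $k$-endomorphism of $k[x_1,\dots,x_n]$ taking every tame coordinate of $k[x_1,\dots,x_n]$ to a coordinate of $k[x_1,\dots,x_n]$. Then $$J(\phi)=J_{x_1,\dots,x_n}(f_1,\dots,f_n):=\det\left[\frac{\partial f_i}{\partial x_j}\right]_{1\le i,j\le n}\in k^*.$$
   Context: A $k$-endomorphism $\phi=(f_1,\dots,f_n)$ of $k[x_1,\dots,x_n]$ is the $k$-algebra homomorphism with $\phi(x_i)=f_i$ for all $i$; it is a $k$-automorphism if it is bijective. A coordinate of $k[x_1,\dots,x_n]$ is a polynomial that is a component of some $k$-automorphism, i.e. equals $g_i$ for some $k$-automorphism $(g_1,\dots,g_n)$ and some $i$. A $k$-automorphism is tame if it can be decomposed as a product (composition) of linear automorphisms and elementary automorphisms, where an elementary automorphism is one of the form $(x_1,\dots,x_{i-1},c\,x_i+f,x_{i+1},\dots,x_n)$ with $c\in k^*$ and $f\in k[x_1,\dots,x_{i-1},x_{i+1},\dots,x_n]$. A coordinate is tame if it is a component of a tame automorphism. Here $k^*=k\setminus\{0\}$. *)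

theory Defs
  imports "HOL-Analysis.Analysis" "HOL-Library.Poly_Mapping"
begin

text \<open>
  The polynomial ring in the variables indexed by the finite type \<open>'n\<close>: finitely supported
  functions from exponent vectors to coefficients, with the convolution product of
  \<^theory>\<open>HOL-Library.Poly_Mapping\<close>. The number of variables is \<open>CARD('n)\<close>, which is at least 1.
\<close>

type_synonym ('n, 'k) mpoly = "('n \<Rightarrow>\<^sub>0 nat) \<Rightarrow>\<^sub>0 'k"

definition pconst :: "'k::zero \<Rightarrow> ('n, 'k) mpoly" where
  "pconst c = Poly_Mapping.single 0 c"

definition pvar :: "'n \<Rightarrow> ('n, 'k::zero_neq_one) mpoly" where
  "pvar i = Poly_Mapping.single (Poly_Mapping.single i 1) 1"

text \<open>
  Formal partial derivative. The truncating subtraction of exponents is harmless: a monomial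
  not containing the variable gets the coefficient 0.
\<close>

definition pderiv_wrt :: "'n \<Rightarrow> ('n, 'k::comm_semiring_1) mpoly \<Rightarrow> ('n, 'k) mpoly" where
  "pderiv_wrt j p =
     (\<Sum>m\<in>Poly_Mapping.keys p.
        Poly_Mapping.single (m - Poly_Mapping.single j 1)
          (of_nat (Poly_Mapping.lookup m j) * Poly_Mapping.lookup p m))"

definition free_of :: "'n \<Rightarrow> ('n, 'k::zero) mpoly \<Rightarrow> bool" where
  "free_of i p \<longleftrightarrow> (\<forall>m\<in>Poly_Mapping.keys p. Poly_Mapping.lookup m i = 0)"

text \<open>
  Endomorphisms are treated as maps on the polynomial ring; the components of \<open>\<phi>\<close> are the
  polynomials \<open>\<phi> (pvar i)\<close>.
\<close>

definition k_endomorphism :: "(('n, 'k::field) mpoly \<Rightarrow> ('n, 'k) mpoly) \<Rightarrow> bool" where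
  "k_endomorphism \<phi> \<longleftrightarrow>
     (\<forall>c. \<phi> (pconst c) = pconst c) \<and>
     (\<forall>p q. \<phi> (p + q) = \<phi> p + \<phi> q) \<and>
     (\<forall>p q. \<phi> (p * q) = \<phi> p * \<phi> q)"

definition k_automorphism :: "(('n, 'k::field) mpoly \<Rightarrow> ('n, 'k) mpoly) \<Rightarrow> bool" where
  "k_automorphism \<phi> \<longleftrightarrow> k_endomorphism \<phi> \<and> bij \<phi>"

definition coordinate :: "('n, 'k::field) mpoly \<Rightarrow> bool" where
  "coordinate p \<longleftrightarrow> (\<exists>\<psi> i. k_automorphism \<psi> \<and> p = \<psi> (pvar i))"

definition linear_automorphism ::
    "(('n::finite, 'k::field) mpoly \<Rightarrow> ('n, 'k) mpoly) \<Rightarrow> bool" where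
  "linear_automorphism \<phi> \<longleftrightarrow> k_automorphism \<phi> \<and>
     (\<exists>A :: 'k^'n^'n. \<forall>i. \<phi> (pvar i) = (\<Sum>j\<in>UNIV. pconst (A $ i $ j) * pvar j))"

definition elementary_automorphism ::
    "(('n, 'k::field) mpoly \<Rightarrow> ('n, 'k) mpoly) \<Rightarrow> bool" where
  "elementary_automorphism \<phi> \<longleftrightarrow> k_automorphism \<phi> \<and>
     (\<exists>i c f. c \<noteq> 0 \<and> free_of i f \<and>
        \<phi> (pvar i) = pconst c * pvar i + f \<and>
        (\<forall>j. j \<noteq> i \<longrightarrow> \<phi> (pvar j) = pvar j))"

inductive tame_automorphism ::
    "(('n::finite, 'k::field) mpoly \<Rightarrow> ('n, 'k) mpoly) \<Rightarrow> bool" where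
  linear: "linear_automorphism \<phi> \<Longrightarrow> tame_automorphism \<phi>"
| elementary: "elementary_automorphism \<phi> \<Longrightarrow> tame_automorphism \<phi>"
| comp: "tame_automorphism \<phi> \<Longrightarrow> tame_automorphism \<psi> \<Longrightarrow> tame_automorphism (\<phi> \<circ> \<psi>)"

definition tame_coordinate :: "('n::finite, 'k::field) mpoly \<Rightarrow> bool" where
  "tame_coordinate p \<longleftrightarrow> (\<exists>\<psi> i. tame_automorphism \<psi> \<and> p = \<psi> (pvar i))"

definition jacobian_det :: "('n::finite \<Rightarrow> ('n, 'k::field) mpoly) \<Rightarrow> ('n, 'k) mpoly" where
  "jacobian_det f = det (\<chi> i j. pderiv_wrt j (f i))"

end

theory Submission
  imports Defs "HOL-Computational_Algebra.Polynomial"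
begin

text \<open>
  The partial derivatives of a coordinate generate the unit ideal, so it suffices to exhibit, when
  \<open>J(\<phi>)\<close> is not a nonzero constant, a tame coordinate \<open>p\<close> such that the gradient of \<open>\<phi>(p)\<close> vanishes at
  some point over an extension field of \<open>k\<close>. By the chain rule the gradient of \<open>p\<close> at the image point
  has to lie in the left kernel of the Jacobian matrix. A tame coordinate defined over \<open>k\<close> can have
  any prescribed nonzero gradient, up to scaling, as soon as one coordinate of the image point generates the
  residue field of the point: take \<open>p = x\<^sub>1 + (\<Sum>i. g\<^sub>i(x\<^sub>0) x\<^sub>i) + G(x\<^sub>0)\<close>, where \<open>x\<^sub>0\<close> is that coordinate.

  Points of this kind exist because \<open>f\<^sub>0 = \<phi>(x\<^sub>0)\<close> is itself a coordinate, say \<open>\<psi>(x\<^sub>l)\<close>. Composing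
  \<open>\<psi>\<^sup>-\<^sup>1\<close> with a Kronecker substitution \<open>x\<^sub>l \<mapsto> X\<close>, \<open>x\<^sub>j \<mapsto> X\<^bsup>w j\<^esup>\<close> gives a homomorphism to \<open>k[X]\<close> that sends
  \<open>f\<^sub>0\<close> to \<open>X\<close> and \<open>J(\<phi>)\<close> to a polynomial that is not a nonzero constant. An irreducible factor \<open>m\<close> of
  the latter defines the point, with residue field \<open>k[X]/(m)\<close>. Everything is phrased as divisibility by
  \<open>m\<close> in \<open>k[X]\<close>, so that no extension field has to be constructed.
\<close>

subsection \<open>Algebra homomorphisms and substitution\<close>

lemma single_sum_one:
  "finite A \<Longrightarrow> Poly_Mapping.single (\<Sum>i\<in>A. g i) (1::'k::comm_semiring_1) = (\<Prod>i\<in>A. Poly_Mapping.single (g i) 1)"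
proof (induction A rule: finite_induct)
  case (insert x F)
  have "Poly_Mapping.single (\<Sum>i\<in>insert x F. g i) (1::'k) =
    Poly_Mapping.single (g x) 1 * Poly_Mapping.single (\<Sum>i\<in>F. g i) 1"
    using insert.hyps by (simp add: mult_single)
  then show ?case using insert by simp
qed simp

lemma pvar_power:
  "(pvar i :: ('n, 'k::comm_semiring_1) mpoly) ^ k = Poly_Mapping.single (Poly_Mapping.single i k) 1"
  by (induction k) (auto simp: pvar_def mult_single single_add[symmetric])

lemma poly_mapping_eq_sum_single:
  "p = (\<Sum>m\<in>Poly_Mapping.keys p. Poly_Mapping.single m (Poly_Mapping.lookup p m))"
proof (rule poly_mapping_eqI)
  fix k
  show "Poly_Mapping.lookup p k = Poly_Mapping.lookup (\<Sum>m\<in>Poly_Mapping.keys p. Poly_Mapping.single m (Poly_Mapping.lookup p m)) k"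
    by (auto simp: lookup_sum lookup_single when_def sum.delta in_keys_iff)
qed

lemma single_eq_pconst_mult_prod:
  fixes c :: "'k::comm_semiring_1"
  shows "(Poly_Mapping.single m c :: ('n::finite, 'k) mpoly) =
     pconst c * (\<Prod>i\<in>UNIV. pvar i ^ Poly_Mapping.lookup m i)"
proof -
  have "m = (\<Sum>i\<in>UNIV. Poly_Mapping.single i (Poly_Mapping.lookup m i))"
    by (rule poly_mapping_eqI) (auto simp: lookup_sum lookup_single when_def sum.delta)
  then have "(Poly_Mapping.single m 1 :: ('n, 'k) mpoly) = (\<Prod>i\<in>UNIV. pvar i ^ Poly_Mapping.lookup m i)"
    by (metis (no_types, lifting) finite pvar_power prod.cong single_sum_one)
  moreover have "Poly_Mapping.single m c = pconst c * Poly_Mapping.single m 1"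
    by (simp add: pconst_def mult_single)
  ultimately show ?thesis by simp
qed

lemma pconst_1 [simp]: "pconst 1 = 1"
  by (simp add: pconst_def)

lemma pconst_0 [simp]: "pconst 0 = 0"
  by (simp add: pconst_def)

lemma pconst_add: "pconst (a + b) = pconst a + pconst b"
  by (simp add: pconst_def single_add)

lemma pconst_mult:
  "(pconst (a * b) :: ('n, 'k::comm_semiring_1) mpoly) = pconst a * pconst b"
  by (simp add: pconst_def mult_single)

text \<open>Constants and variables generate the polynomial ring. Uniqueness of homomorphisms and
  the chain rule are both checked on these generators.\<close>

lemma mpoly_induct [case_names const var add mult]:
  fixes p :: "('n::finite, 'k::comm_semiring_1) mpoly"
  assumes "\<And>c. P (pconst c)" "\<And>i. P (pvar i)"
    and add: "\<And>p q. P p \<Longrightarrow> P q \<Longrightarrow> P (p + q)" and mult: "\<And>p q. P p \<Longrightarrow> P q \<Longrightarrow> P (p * q)"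
  shows "P p"
proof -
  have 0: "P 0" "P 1" using assms(1)[of 0] assms(1)[of 1] by auto
  have pow: "P (q ^ k)" if "P q" for q k
    using that 0 by (induction k) (auto intro: mult)
  have prod: "P (\<Prod>i\<in>A. g i)" if "finite A" "\<And>i. P (g i)" for g and A :: "'n set"
    using that by (induction A rule: finite_induct) (auto intro: mult 0)
  then have "P (Poly_Mapping.single m c)" for m c
    unfolding single_eq_pconst_mult_prod by (intro mult prod pow assms finite)
  moreover have "P (\<Sum>m\<in>A. g m)" if "finite A" "\<And>m. P (g m)" for g and A :: "('n \<Rightarrow>\<^sub>0 nat) set"
    using that by (induction A rule: finite_induct) (auto intro: add 0)
  ultimately show ?thesis
    by (subst poly_mapping_eq_sum_single) simp
qed

text \<open>The target is any commutative ring with structure map \<open>\<kappa>\<close>, so that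
  one theory covers endomorphisms (\<open>pconst\<close>) and evaluations in \<open>k[X]\<close>
  (\<open>\<lambda>c. [:c:]\<close>). Additivity and multiplicativity of \<open>\<kappa>\<close> are
  inherited from \<open>h\<close>.\<close>

definition alg_hom :: "('k::field \<Rightarrow> 'r::comm_ring_1) \<Rightarrow> (('n, 'k) mpoly \<Rightarrow> 'r) \<Rightarrow> bool" where
  "alg_hom \<kappa> h \<longleftrightarrow> \<kappa> 1 = 1 \<and> (\<forall>c. h (pconst c) = \<kappa> c) \<and>
     (\<forall>p q. h (p + q) = h p + h q) \<and> (\<forall>p q. h (p * q) = h p * h q)"

lemma k_endomorphism_iff_alg_hom: "k_endomorphism \<phi> \<longleftrightarrow> alg_hom pconst \<phi>"
  by (auto simp: k_endomorphism_def alg_hom_def)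

context
  fixes \<kappa> :: "'k::field \<Rightarrow> 'r::comm_ring_1" and h :: "('n, 'k) mpoly \<Rightarrow> 'r"
  assumes h: "alg_hom \<kappa> h"
begin

lemma alg_hom_pconst: "h (pconst c) = \<kappa> c"
  using h by (simp add: alg_hom_def)

lemma alg_hom_add: "h (p + q) = h p + h q"
  using h by (simp add: alg_hom_def)

lemma alg_hom_mult: "h (p * q) = h p * h q"
  using h by (simp add: alg_hom_def)

lemma alg_hom_1: "h 1 = 1"
  using h by (metis alg_hom_def pconst_1)

lemma alg_hom_0: "h 0 = 0"
  using alg_hom_add[of 0 0] by simp

lemma alg_hom_uminus: "h (- p) = - h p"
  using alg_hom_add[of p "- p"] by (simp add: alg_hom_0 add_eq_0_iff)

lemma alg_hom_diff: "h (p - q) = h p - h q"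
  using alg_hom_add[of p "- q"] by (simp add: alg_hom_uminus)

lemma alg_hom_sum: "h (\<Sum>i\<in>A. g i) = (\<Sum>i\<in>A. h (g i))"
  by (induction A rule: infinite_finite_induct) (auto simp: alg_hom_0 alg_hom_add)

lemma alg_hom_prod: "h (\<Prod>i\<in>A. g i) = (\<Prod>i\<in>A. h (g i))"
  by (induction A rule: infinite_finite_induct) (auto simp: alg_hom_1 alg_hom_mult)

lemma alg_hom_of_nat: "h (of_nat k) = of_nat k"
  by (induction k) (auto simp: alg_hom_0 alg_hom_1 alg_hom_add)

lemma alg_hom_of_int: "h (of_int k) = of_int k"
  by (cases k rule: int_diff_cases) (simp add: alg_hom_diff alg_hom_of_nat)

text \<open>The Leibniz formula is an integer polynomial in the entries.\<close>

lemma alg_hom_det: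
  fixes A :: "('n, 'k) mpoly^'m^'m"
  shows "h (det A) = det (\<chi> i j. h (A $ i $ j))"
  by (simp only: det_def alg_hom_sum alg_hom_mult alg_hom_prod alg_hom_of_int vec_lambda_beta)

lemmas alg_hom_simps = alg_hom_pconst alg_hom_add alg_hom_mult alg_hom_1 alg_hom_0
  alg_hom_uminus alg_hom_diff alg_hom_sum

end

lemma alg_hom_comp: "k_endomorphism \<phi> \<Longrightarrow> alg_hom \<kappa> h \<Longrightarrow> alg_hom \<kappa> (h \<circ> \<phi>)"
  by (simp add: alg_hom_def k_endomorphism_def)

lemma alg_hom_ext:
  fixes p :: "('n::finite, 'k::field) mpoly"
  assumes "alg_hom \<kappa> h" "alg_hom \<kappa> h'" "\<And>i. h (pvar i) = h' (pvar i)"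
  shows "h p = h' p"
  by (induction p rule: mpoly_induct) (use assms in \<open>auto simp: alg_hom_def\<close>)

section \<open>Evaluation at a point, with coefficients mapped along a ring homomorphism\<close>

definition insertion ::
    "('k::field \<Rightarrow> 'r::comm_ring_1) \<Rightarrow> ('n::finite \<Rightarrow> 'r) \<Rightarrow> ('n, 'k) mpoly \<Rightarrow> 'r" where
  "insertion \<kappa> v p = (\<Sum>m\<in>Poly_Mapping.keys p.
     \<kappa> (Poly_Mapping.lookup p m) * (\<Prod>i\<in>UNIV. v i ^ Poly_Mapping.lookup m i))"

context
  fixes \<kappa> :: "'k::field \<Rightarrow> 'r::comm_ring_1"
  assumes \<kappa>_1: "\<kappa> 1 = 1" and \<kappa>_add: "\<And>a b. \<kappa> (a + b) = \<kappa> a + \<kappa> b"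
    and \<kappa>_mult: "\<And>a b. \<kappa> (a * b) = \<kappa> a * \<kappa> b"
begin

lemma coeff_hom_0: "\<kappa> 0 = 0"
  using \<kappa>_add[of 0 0] by simp

lemma insertion_add: "insertion \<kappa> v (p + q) = insertion \<kappa> v p + insertion \<kappa> v q"
  unfolding insertion_def
  by (rule setsum_keys_plus_distrib) (simp_all add: coeff_hom_0 \<kappa>_add distrib_right)

lemma insertion_single:
  "insertion \<kappa> v (Poly_Mapping.single m c) = \<kappa> c * (\<Prod>i\<in>UNIV. v i ^ Poly_Mapping.lookup m i)"
  by (auto simp: insertion_def coeff_hom_0)

lemma insertion_sum: "insertion \<kappa> v (\<Sum>i\<in>A. g i) = (\<Sum>i\<in>A. insertion \<kappa> v (g i))"
proof (induction A rule: infinite_finite_induct)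
qed (auto simp: insertion_add, auto simp: insertion_def)

lemma insertion_mult: "insertion \<kappa> v (p * q) = insertion \<kappa> v p * insertion \<kappa> v q"
proof -
  let ?p = "\<lambda>m. Poly_Mapping.single m (Poly_Mapping.lookup p m)"
  let ?q = "\<lambda>m. Poly_Mapping.single m (Poly_Mapping.lookup q m)"
  have "insertion \<kappa> v (?p a * ?q b) = insertion \<kappa> v (?p a) * insertion \<kappa> v (?q b)" for a b
    by (simp add: mult_single insertion_single \<kappa>_mult lookup_add power_add prod.distrib algebra_simps)
  then have "insertion \<kappa> v ((\<Sum>a\<in>Poly_Mapping.keys p. ?p a) * (\<Sum>b\<in>Poly_Mapping.keys q. ?q b)) =
    insertion \<kappa> v (\<Sum>a\<in>Poly_Mapping.keys p. ?p a) * insertion \<kappa> v (\<Sum>b\<in>Poly_Mapping.keys q. ?q b)"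
    by (simp only: sum_product insertion_sum)
  then show ?thesis
    by (simp only: poly_mapping_eq_sum_single[symmetric])
qed

lemma alg_hom_insertion: "alg_hom \<kappa> (insertion \<kappa> v)"
  by (simp add: alg_hom_def \<kappa>_1 insertion_add insertion_mult pconst_def insertion_single)

lemma insertion_pvar: "insertion \<kappa> v (pvar i) = v i"
proof -
  have "(\<Prod>j\<in>UNIV. v j ^ Poly_Mapping.lookup (Poly_Mapping.single i 1) j) = (\<Prod>j\<in>UNIV. if j = i then v j else 1)"
    by (rule prod.cong) (auto simp: lookup_single when_def)
  then show ?thesis by (simp add: pvar_def insertion_single \<kappa>_1)
qed

end

text \<open>Makes an elementary substitution in the variable \<open>i\<close> fix the polynomials
  free of \<open>i\<close>.\<close>

lemma insertion_cong_free_of: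
  assumes "free_of i p" "\<And>j. j \<noteq> i \<Longrightarrow> v j = w j"
  shows "insertion \<kappa> v p = insertion \<kappa> w p"
  unfolding insertion_def
proof (intro sum.cong refl arg_cong2[of _ _ _ _ "(*)"] prod.cong)
  fix m j assume "m \<in> Poly_Mapping.keys p"
  then show "v j ^ Poly_Mapping.lookup m j = w j ^ Poly_Mapping.lookup m j"
    using assms by (cases "j = i") (auto simp: free_of_def)
qed

lemmas alg_hom_pinsertion = alg_hom_insertion[of pconst, OF pconst_1 pconst_add pconst_mult]
lemmas pinsertion_pvar = insertion_pvar[of pconst, OF pconst_1 pconst_add pconst_mult]

lemma k_endomorphism_eq_insertion:
  fixes p :: "('n::finite, 'k::field) mpoly"
  assumes "k_endomorphism \<phi>"
  shows "\<phi> p = insertion pconst (\<lambda>i. \<phi> (pvar i)) p"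
  by (rule alg_hom_ext[of pconst])
    (use assms in \<open>auto simp: k_endomorphism_iff_alg_hom alg_hom_pinsertion pinsertion_pvar\<close>)

subsection \<open>Partial derivatives and the chain rule\<close>

lemma pderiv_wrt_add: "pderiv_wrt j (p + q) = pderiv_wrt j p + pderiv_wrt j q"
  unfolding pderiv_wrt_def
  by (rule setsum_keys_plus_distrib) (simp_all add: distrib_left single_add)

lemma pderiv_wrt_single: "pderiv_wrt j (Poly_Mapping.single m c) =
    Poly_Mapping.single (m - Poly_Mapping.single j 1) (of_nat (Poly_Mapping.lookup m j) * c)"
  by (auto simp: pderiv_wrt_def)

lemma pderiv_wrt_pconst [simp]: "pderiv_wrt j (pconst c) = 0"
  by (simp add: pconst_def pderiv_wrt_single)

lemma pderiv_wrt_0 [simp]: "pderiv_wrt j 0 = 0"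
  by (simp add: pderiv_wrt_def)

lemma pderiv_wrt_sum: "pderiv_wrt j (\<Sum>i\<in>A. g i) = (\<Sum>i\<in>A. pderiv_wrt j (g i))"
  by (induction A rule: infinite_finite_induct) (auto simp: pderiv_wrt_add)

lemma pderiv_wrt_pvar: "pderiv_wrt j (pvar i :: ('n, 'k::comm_semiring_1) mpoly) = (if i = j then 1 else 0)"
  by (auto simp: pvar_def pderiv_wrt_single lookup_single)

text \<open>Both sides are biadditive, which reduces the rule to products of two monomials.\<close>

lemma pderiv_wrt_mult:
  fixes p q :: "('n, 'k::comm_semiring_1) mpoly"
  shows "pderiv_wrt j (p * q) = pderiv_wrt j p * q + p * pderiv_wrt j q"
proof -
  let ?p = "\<lambda>m. Poly_Mapping.single m (Poly_Mapping.lookup p m)"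
  let ?q = "\<lambda>m. Poly_Mapping.single m (Poly_Mapping.lookup q m)"
  have single: "pderiv_wrt j (?p a * ?q b) = pderiv_wrt j (?p a) * ?q b + ?p a * pderiv_wrt j (?q b)" for a b
  proof -
    let ?e = "Poly_Mapping.single j (1::nat)"
    \<comment> \<open>Lowering the exponent of \<open>j\<close> commutes with the addition where
      that exponent is positive; where it is 0, truncation may give a different monomial, but with
      coefficient 0.\<close>
    have 1: "a + b - ?e = a - ?e + b" if "Poly_Mapping.lookup a j \<noteq> 0"
      using that by (intro poly_mapping_eqI) (auto simp: lookup_add lookup_minus lookup_single when_def)
    have 2: "a + b - ?e = a + (b - ?e)" if "Poly_Mapping.lookup b j \<noteq> 0"
      using that by (intro poly_mapping_eqI) (auto simp: lookup_add lookup_minus lookup_single when_def)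
    have "pderiv_wrt j (?p a) * ?q b = Poly_Mapping.single (a + b - ?e)
        (of_nat (Poly_Mapping.lookup a j) * Poly_Mapping.lookup p a * Poly_Mapping.lookup q b)"
      by (cases "Poly_Mapping.lookup a j = 0") (simp_all add: pderiv_wrt_single mult_single 1 del: One_nat_def)
    moreover have "?p a * pderiv_wrt j (?q b) = Poly_Mapping.single (a + b - ?e)
        (of_nat (Poly_Mapping.lookup b j) * Poly_Mapping.lookup p a * Poly_Mapping.lookup q b)"
      by (cases "Poly_Mapping.lookup b j = 0") (simp_all add: pderiv_wrt_single mult_single 2 mult_ac del: One_nat_def)
    ultimately show ?thesis
      by (simp only: mult_single pderiv_wrt_single lookup_add single_add[symmetric] of_nat_add
          distrib_right mult.assoc)
  qed
  have "pderiv_wrt j ((\<Sum>a\<in>Poly_Mapping.keys p. ?p a) * (\<Sum>b\<in>Poly_Mapping.keys q. ?q b)) =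
    pderiv_wrt j (\<Sum>a\<in>Poly_Mapping.keys p. ?p a) * (\<Sum>b\<in>Poly_Mapping.keys q. ?q b) +
    (\<Sum>a\<in>Poly_Mapping.keys p. ?p a) * pderiv_wrt j (\<Sum>b\<in>Poly_Mapping.keys q. ?q b)"
    by (simp only: sum_product pderiv_wrt_sum single sum.distrib)
  then show ?thesis
    by (simp only: poly_mapping_eq_sum_single[symmetric])
qed

text \<open>As functions of \<open>p\<close>, both sides obey the same sum and product rules along
  \<open>\<phi>\<close>, so agreement on constants and variables suffices.\<close>

lemma pderiv_wrt_k_endomorphism:
  fixes p :: "('n::finite, 'k::field) mpoly"
  assumes "k_endomorphism \<phi>"
  shows "pderiv_wrt j (\<phi> p) = (\<Sum>i\<in>UNIV. \<phi> (pderiv_wrt i p) * pderiv_wrt j (\<phi> (pvar i)))"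
proof -
  have \<phi>: "alg_hom pconst \<phi>" using assms by (simp add: k_endomorphism_iff_alg_hom)
  show ?thesis
  proof (induction p rule: mpoly_induct)
    case (const c)
    then show ?case by (simp add: alg_hom_simps[OF \<phi>])
  next
    case (var i)
    have "(\<Sum>k\<in>UNIV. \<phi> (pderiv_wrt k (pvar i)) * pderiv_wrt j (\<phi> (pvar k))) =
      (\<Sum>k\<in>UNIV. if k = i then pderiv_wrt j (\<phi> (pvar k)) else 0)"
      by (rule sum.cong) (auto simp: pderiv_wrt_pvar alg_hom_simps[OF \<phi>])
    then show ?case by simp
  next
    case (add p q)
    then show ?case
      by (simp add: pderiv_wrt_add alg_hom_simps[OF \<phi>] distrib_right sum.distrib)
  next
    case (mult p q)
    let ?d = "\<lambda>i. pderiv_wrt j (\<phi> (pvar i))"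
    have "(\<Sum>i\<in>UNIV. \<phi> (pderiv_wrt i (p * q)) * ?d i) =
      (\<Sum>i\<in>UNIV. \<phi> (pderiv_wrt i p) * ?d i * \<phi> q + \<phi> p * (\<phi> (pderiv_wrt i q) * ?d i))"
      by (rule sum.cong) (simp_all add: pderiv_wrt_mult alg_hom_simps[OF \<phi>] algebra_simps)
    then show ?case
      by (simp add: pderiv_wrt_mult alg_hom_mult[OF \<phi>] sum.distrib mult.IH
          flip: sum_distrib_left sum_distrib_right)
  qed
qed

section \<open>Unimodularity of the gradient of a coordinate\<close>

lemma k_endomorphism_inv:
  assumes "k_automorphism \<psi>"
  shows "k_endomorphism (inv \<psi>)" "\<And>p. inv \<psi> (\<psi> p) = p" "\<And>p. \<psi> (inv \<psi> p) = p"
proof -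
  have e: "k_endomorphism \<psi>" and b: "bij \<psi>" using assms by (auto simp: k_automorphism_def)
  show 1: "inv \<psi> (\<psi> p) = p" for p using b by (simp add: bij_is_inj)
  show 2: "\<psi> (inv \<psi> p) = p" for p using b by (simp add: bij_is_surj surj_f_inv_f)
  show "k_endomorphism (inv \<psi>)"
    unfolding k_endomorphism_def
  proof (intro conjI allI)
    fix c p q
    show "inv \<psi> (pconst c) = pconst c"
      using e 1[of "pconst c"] by (simp add: k_endomorphism_def)
    show "inv \<psi> (p + q) = inv \<psi> p + inv \<psi> q"
      using e 1[of "inv \<psi> p + inv \<psi> q"] by (simp add: k_endomorphism_def 2)
    show "inv \<psi> (p * q) = inv \<psi> p * inv \<psi> q"
      using e 1[of "inv \<psi> p * inv \<psi> q"] by (simp add: k_endomorphism_def 2)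
  qed
qed

text \<open>For \<open>u = \<psi> (pvar i)\<close>, differentiate
  \<open>inv \<psi> u = pvar i\<close> by the chain rule and apply \<open>\<psi>\<close>. Hence no
  homomorphism to a nonzero ring kills the whole gradient of a coordinate.\<close>

lemma coordinate_pderiv_unimodular:
  fixes u :: "('n::finite, 'k::field) mpoly"
  assumes "coordinate u"
  obtains w where "(\<Sum>j\<in>UNIV. pderiv_wrt j u * w j) = 1"
proof -
  obtain \<psi> i where \<psi>: "k_automorphism \<psi>" and u: "u = \<psi> (pvar i)"
    using assms by (auto simp: coordinate_def)
  note inv = k_endomorphism_inv[OF \<psi>]
  have e: "alg_hom pconst \<psi>" using \<psi> by (simp add: k_automorphism_def k_endomorphism_iff_alg_hom)
  have "pderiv_wrt i (inv \<psi> u) = 1" by (simp add: u inv pderiv_wrt_pvar)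
  then have "\<psi> (\<Sum>j\<in>UNIV. inv \<psi> (pderiv_wrt j u) * pderiv_wrt i (inv \<psi> (pvar j))) = 1"
    using alg_hom_1[OF e] by (simp only: pderiv_wrt_k_endomorphism[OF inv(1), of i u, symmetric])
  then have "(\<Sum>j\<in>UNIV. pderiv_wrt j u * \<psi> (pderiv_wrt i (inv \<psi> (pvar j)))) = 1"
    by (simp add: alg_hom_simps[OF e] inv)
  then show ?thesis by (rule that)
qed

subsection \<open>Linear algebra modulo a univariate polynomial\<close>

text \<open>
  A divisor of least positive degree is irreducible; this avoids gcds of polynomials over \<open>'k\<close>, which
  would need the class \<open>field_gcd\<close>. For \<open>G = 0\<close> the divisor is \<open>X\<close>.
\<close>

lemma exists_residue_field_divisor:
  fixes G :: "'k::field poly"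
  assumes "\<nexists>c. c \<noteq> 0 \<and> G = [:c:]"
  shows "\<exists>m. \<not> m dvd 1 \<and> m dvd G \<and> (\<forall>a. \<not> m dvd a \<longrightarrow> (\<exists>b. m dvd a * b - 1))"
proof -
  let ?P = "\<lambda>m. 0 < degree m \<and> m dvd G"
  have "\<exists>m. ?P m"
  proof (cases "G = 0")
    case True
    then show ?thesis by (intro exI[of _ "[:0, 1:]"]) simp
  next
    case False
    then have "0 < degree G" using assms by (metis degree_eq_zeroE gr0I pCons_0_0)
    then show ?thesis by auto
  qed
  then obtain m where m: "?P m" and min: "\<And>q. ?P q \<Longrightarrow> degree m \<le> degree q"
    by (metis ex_has_least_nat[of ?P _ degree])
  have m0: "m \<noteq> 0" using m by auto
  then have not_unit: "\<not> m dvd 1" using m by (simp add: is_unit_iff_degree)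
  \<comment> \<open>Euclidean descent: if \<open>m = a * s + t\<close>, then \<open>t\<close> is
    congruent to \<open>- a * s\<close> modulo \<open>m\<close>, so an inverse of the smaller
    \<open>t\<close> yields one of \<open>a\<close>.\<close>
  have small: "\<exists>b. m dvd a * b - 1" if "a \<noteq> 0" "degree a < degree m" for a
    using that
  proof (induction "degree a" arbitrary: a rule: less_induct)
    case less
    show ?case
    proof (cases "degree a = 0")
      case True
      then have "a dvd 1" using less.prems by (simp add: is_unit_iff_degree)
      then show ?thesis by (metis dvdE dvd_0_right right_minus_eq)
    next
      case False
      define s t where "s = m div a" and "t = m mod a"
      have eq: "m = a * s + t" by (simp add: s_def t_def)
      \<comment> \<open>Otherwise \<open>a\<close> would be a divisor of \<open>G\<close> of
        positive degree smaller than that of \<open>m\<close>.\<close>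
      have "t \<noteq> 0"
      proof
        assume "t = 0"
        then have "a dvd G" using eq m by (metis add_0_right dvd_mult_left)
        then show False using False min[of a] less.prems(2) by simp
      qed
      then have "degree t < degree a"
        using degree_mod_less'[OF less.prems(1)] by (simp add: t_def)
      with \<open>t \<noteq> 0\<close> obtain b where b: "m dvd t * b - 1"
        using less.hyps[of t] less.prems by (meson less_trans)
      have "m * b = a * s * b + t * b" by (simp only: eq distrib_right)
      then have "a * (- s * b) - 1 = (t * b - 1) - m * b" by (simp add: mult.assoc)
      then show ?thesis using b by (metis dvd_diff dvd_triv_left)
    qed
  qed
  have "\<exists>b. m dvd a * b - 1" if "\<not> m dvd a" for a
  proof -
    have "a mod m \<noteq> 0" using that by (simp add: dvd_eq_mod_eq_0)
    then obtain b where "m dvd (a mod m) * b - 1"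
      using small degree_mod_less'[OF m0] by blast
    moreover have "a * b - 1 = ((a mod m) * b - 1) + m * (a div m * b)"
      by (subst (1) div_mult_mod_eq[of a m, symmetric]) (simp only: algebra_simps)
    ultimately show ?thesis by (metis dvd_add dvd_triv_left)
  qed
  with not_unit m show ?thesis by blast
qed

context
  fixes m :: "'r::comm_ring_1"
  assumes inverse_mod: "\<forall>a. \<not> m dvd a \<longrightarrow> (\<exists>b. m dvd a * b - 1)"
    and not_unit: "\<not> m dvd 1"
begin

text \<open>The context says that the quotient by \<open>m\<close> is a field. Over it, more vectors
  than coordinates are dependent, by Gaussian elimination one column at a time.\<close>

lemma linear_dependence_mod:
  assumes "finite I" "finite J" "card J < card I"
  shows "\<exists>c. (\<exists>i\<in>I. \<not> m dvd c i) \<and> (\<forall>j\<in>J. m dvd (\<Sum>i\<in>I. c i * A i j))"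
  using assms(2,1,3)
proof (induction J arbitrary: I A rule: finite_induct)
  case empty
  then have "I \<noteq> {}" by auto
  then show ?case using not_unit by (intro exI[of _ "\<lambda>_. 1"]) auto
next
  case (insert j J)
  show ?case
  proof (cases "\<forall>i\<in>I. m dvd A i j")
    case True
    obtain c where "\<exists>i\<in>I. \<not> m dvd c i" "\<forall>j\<in>J. m dvd (\<Sum>i\<in>I. c i * A i j)"
      using insert.IH[of I A] insert.prems insert.hyps by auto
    moreover have "m dvd (\<Sum>i\<in>I. c i * A i j)"
      using True by (auto intro: dvd_sum)
    ultimately show ?thesis by (intro exI[of _ c]) auto
  next
    case False
    then obtain i0 b where i0: "i0 \<in> I" and b: "m dvd A i0 j * b - 1"
      using inverse_mod by blast
    \<comment> \<open>Row \<open>i0\<close> is the pivot and \<open>b\<close> inverts its entry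
      modulo \<open>m\<close>; the rows \<open>?A\<close> have column \<open>j\<close> cleared
      modulo \<open>m\<close>.\<close>
    let ?I = "I - {i0}"
    let ?A = "\<lambda>i k. A i k - A i j * b * A i0 k"
    have "card J < card ?I" using insert.prems insert.hyps i0 by simp
    then obtain c where c: "\<exists>i\<in>?I. \<not> m dvd c i" "\<And>k. k \<in> J \<Longrightarrow> m dvd (\<Sum>i\<in>?I. c i * ?A i k)"
      using insert.IH[of ?I ?A] insert.prems by auto
    \<comment> \<open>The pivot coefficient collects the multiples of row \<open>i0\<close>
      subtracted in \<open>?A\<close>, so that the two combinations agree exactly, not just modulo
      \<open>m\<close>.\<close>
    let ?c = "c(i0 := - (\<Sum>i\<in>?I. c i * A i j * b))"
    have eq: "(\<Sum>i\<in>I. ?c i * A i k) = (\<Sum>i\<in>?I. c i * ?A i k)" for k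
    proof -
      have "(\<Sum>i\<in>I. ?c i * A i k) = ?c i0 * A i0 k + (\<Sum>i\<in>?I. ?c i * A i k)"
        using insert.prems i0 by (simp add: sum.remove)
      also have "(\<Sum>i\<in>?I. ?c i * A i k) = (\<Sum>i\<in>?I. c i * A i k)"
        by (rule sum.cong) auto
      finally show ?thesis
        by (simp add: sum_subtractf sum_distrib_right right_diff_distrib mult.assoc)
    qed
    have "m dvd (\<Sum>i\<in>?I. c i * ?A i j)"
    proof (rule dvd_sum)
      fix i
      have "c i * ?A i j = (A i0 j * b - 1) * (- c i * A i j)" by (simp add: algebra_simps)
      then show "m dvd c i * ?A i j" using b by (metis dvd_mult2)
    qed
    then have "\<forall>k\<in>insert j J. m dvd (\<Sum>i\<in>I. ?c i * A i k)"
      unfolding eq using c by auto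
    moreover have "\<exists>i\<in>I. \<not> m dvd ?c i" using c(1) by auto
    ultimately show ?thesis by blast
  qed
qed

lemma prod_cong_mod:
  "(\<And>i. i \<in> S \<Longrightarrow> m dvd f i - g i) \<Longrightarrow> m dvd (\<Prod>i\<in>S. f i) - (\<Prod>i\<in>S. g i)"
proof (induction S rule: infinite_finite_induct)
  case (insert x S)
  have "(\<Prod>i\<in>insert x S. f i) - (\<Prod>i\<in>insert x S. g i) =
      (f x - g x) * (\<Prod>i\<in>S. f i) + g x * ((\<Prod>i\<in>S. f i) - (\<Prod>i\<in>S. g i))"
    using insert.hyps by (simp add: algebra_simps)
  moreover have "m dvd (\<Prod>i\<in>S. f i) - (\<Prod>i\<in>S. g i)" "m dvd f x - g x"
    using insert by auto
  ultimately show ?case by simp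
qed auto

lemma det_cong_mod:
  fixes A B :: "'r^'n^'n"
  assumes "\<And>i j. m dvd A $ i $ j - B $ i $ j"
  shows "m dvd det A - det B"
proof -
  have "det A - det B = (\<Sum>p | p permutes UNIV.
      of_int (sign p) * ((\<Prod>i\<in>UNIV. A $ i $ p i) - (\<Prod>i\<in>UNIV. B $ i $ p i)))"
    by (simp add: det_def sum_subtractf right_diff_distrib)
  then show ?thesis
    by (simp only:) (intro dvd_sum dvd_mult prod_cong_mod assms)
qed

text \<open>If the rows were independent modulo \<open>m\<close>, they would span every unit vector.
  This gives a left inverse of \<open>A\<close> modulo \<open>m\<close>, and multiplicativity of
  \<open>det\<close> makes \<open>det A\<close> invertible modulo \<open>m\<close>.\<close>

lemma row_dependence_mod_of_dvd_det:
  fixes A :: "'r^'n^'n"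
  assumes "m dvd det A"
  obtains c where "\<exists>i. \<not> m dvd c i" "\<And>j. m dvd (\<Sum>i\<in>UNIV. c i * A $ i $ j)"
proof (rule ccontr)
  note that' = that
  assume "\<not> thesis"
  then have indep: "\<forall>i. m dvd c i" if "\<And>j. m dvd (\<Sum>i\<in>UNIV. c i * A $ i $ j)" for c
    using that that' by blast
  have "\<exists>r. \<forall>j. m dvd (\<Sum>i\<in>UNIV. r i * A $ i $ j) - (if l = j then 1 else 0)" for l
  proof -
    \<comment> \<open>The rows together with the \<open>l\<close>-th unit vector are one vector too many.\<close>
    let ?A = "\<lambda>i j. case i of None \<Rightarrow> if l = j then 1 else 0 | Some i \<Rightarrow> A $ i $ j"
    have "card (UNIV :: 'n set) < card (UNIV :: 'n option set)"
      by (simp add: UNIV_option_conv card_image)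
    from linear_dependence_mod[OF _ _ this, of ?A]
    obtain c where c: "\<exists>i. \<not> m dvd c i" "\<And>j. m dvd (\<Sum>i\<in>UNIV. c i * ?A i j)"
      by auto
    let ?d = "\<lambda>i. c (Some i)"
    have sum: "(\<Sum>i\<in>UNIV. c i * ?A i j) =
        c None * (if l = j then 1 else 0) + (\<Sum>i\<in>UNIV. ?d i * A $ i $ j)" for j
      by (simp add: UNIV_option_conv sum.reindex)
    \<comment> \<open>Otherwise the relation would be one among the rows alone. Inverting this
      coefficient then solves the relation for the unit vector.\<close>
    have "\<not> m dvd c None"
    proof
      assume None: "m dvd c None"
      then have "m dvd (\<Sum>i\<in>UNIV. ?d i * A $ i $ j)" for j
        using c(2)[of j] unfolding sum by (metis dvd_add_right_iff dvd_mult2)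
      then have "\<forall>i. m dvd ?d i" by (rule indep)
      then show False using c(1) None by (metis option.exhaust)
    qed
    then obtain b where b: "m dvd c None * b - 1" using inverse_mod by blast
    show ?thesis
    proof (intro exI allI)
      fix j
      let ?\<delta> = "if l = j then 1 else 0 :: 'r"
      have "(\<Sum>i\<in>UNIV. - b * ?d i * A $ i $ j) - ?\<delta> =
          (c None * b - 1) * ?\<delta> - b * (c None * ?\<delta> + (\<Sum>i\<in>UNIV. ?d i * A $ i $ j))"
        by (simp add: sum_distrib_left sum_negf algebra_simps)
      moreover have "m dvd (c None * b - 1) * ?\<delta>" using b by (rule dvd_mult2)
      moreover have "m dvd b * (c None * ?\<delta> + (\<Sum>i\<in>UNIV. ?d i * A $ i $ j))"
        using c(2)[of j] unfolding sum by (rule dvd_mult)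
      ultimately show "m dvd (\<Sum>i\<in>UNIV. - b * ?d i * A $ i $ j) - ?\<delta>"
        by (simp only: dvd_diff)
    qed
  qed
  then obtain r where r: "\<And>l j. m dvd (\<Sum>i\<in>UNIV. r l i * A $ i $ j) - (if l = j then 1 else 0)"
    by metis
  let ?B = "(\<chi> l i. r l i) :: 'r^'n^'n"
  have "m dvd det (?B ** A) - det (mat 1 :: 'r^'n^'n)"
    by (rule det_cong_mod) (use r in \<open>simp add: matrix_matrix_mult_def mat_def\<close>)
  then have "m dvd det ?B * det A - 1" by (simp add: det_mul)
  moreover have "m dvd det ?B * det A" using assms by simp
  ultimately have "m dvd det ?B * det A - (det ?B * det A - 1)" by (rule dvd_diff[rotated])
  then show False using not_unit by simp
qed

end

subsection \<open>Kronecker substitution\<close>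

text \<open>The weights are powers of \<open>N\<close>, so a weighted sum is a number with
  base-\<open>N\<close> digits \<open>a i\<close>, and digits are unique. The units digit belongs to
  \<open>x\<close>.\<close>

lemma exists_separating_weights:
  fixes N :: nat
  assumes "finite A" "x \<notin> A" "0 < N"
  shows "\<exists>w. (\<forall>i. 0 < w i) \<and> w x = 1 \<and> (\<forall>a b. (\<forall>i. a i < N) \<longrightarrow> (\<forall>i. b i < N) \<longrightarrow>
     (\<Sum>i\<in>insert x A. a i * w i) = (\<Sum>i\<in>insert x A. b i * w i) \<longrightarrow> (\<forall>i\<in>insert x A. a i = b i))"
  using assms(1,2)
proof (induction A arbitrary: x rule: finite_induct)
  case empty
  then show ?case by (intro exI[of _ "\<lambda>_. 1"]) auto
next
  case (insert y A)
  obtain w where w: "\<And>i. 0 < w i" and inj: "\<And>a b. (\<And>i. a i < N) \<Longrightarrow> (\<And>i. b i < N) \<Longrightarrow>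
     (\<Sum>i\<in>insert y A. a i * w i) = (\<Sum>i\<in>insert y A. b i * w i) \<Longrightarrow> \<forall>i\<in>insert y A. a i = b i"
    using insert.IH[OF insert.hyps(2)] by blast
  \<comment> \<open>All old digits move up one place, which frees the units place for
    \<open>x\<close>.\<close>
  let ?w = "\<lambda>i. if i = x then 1 else N * w i"
  have sum: "(\<Sum>i\<in>insert x (insert y A). a i * ?w i) = a x + N * (\<Sum>i\<in>insert y A. a i * w i)" for a
  proof -
    have "(\<Sum>i\<in>insert x (insert y A). a i * ?w i) = a x + (\<Sum>i\<in>insert y A. a i * ?w i)"
      using insert.hyps(1) insert.prems by (subst sum.insert) auto
    also have "(\<Sum>i\<in>insert y A. a i * ?w i) = (\<Sum>i\<in>insert y A. N * (a i * w i))"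
      using insert.prems by (intro sum.cong) auto
    finally show ?thesis by (simp only: sum_distrib_left)
  qed
  show ?case
  proof (intro exI[of _ ?w] conjI allI impI)
    show "0 < ?w i" for i using w assms(3) by simp
    show "?w x = 1" by simp
    fix a b :: "'a \<Rightarrow> nat"
    assume lt: "\<forall>i. a i < N" "\<forall>i. b i < N"
      and "(\<Sum>i\<in>insert x (insert y A). a i * ?w i) = (\<Sum>i\<in>insert x (insert y A). b i * ?w i)"
    then have eq: "a x + N * (\<Sum>i\<in>insert y A. a i * w i) = b x + N * (\<Sum>i\<in>insert y A. b i * w i)"
      by (simp only: sum)
    have "a x = b x"
      using arg_cong[OF eq, of "\<lambda>t. t mod N"] lt by simp
    moreover have "(\<Sum>i\<in>insert y A. a i * w i) = (\<Sum>i\<in>insert y A. b i * w i)"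
      using arg_cong[OF eq, of "\<lambda>t. t div N"] lt assms(3) by simp
    then have "\<forall>i\<in>insert y A. a i = b i" using lt by (intro inj) auto
    ultimately show "\<forall>i\<in>insert x (insert y A). a i = b i" by simp
  qed
qed

text \<open>Distinct monomials of \<open>p\<close> go to distinct powers of \<open>X\<close>, so
  nothing cancels and a nonconstant monomial of \<open>p\<close> survives.\<close>

lemma exists_alg_hom_nonconst:
  fixes p :: "('n::finite, 'k::field) mpoly"
  assumes "\<nexists>c. c \<noteq> 0 \<and> p = pconst c"
  obtains h where "alg_hom (\<lambda>c. [:c:]) h" "h (pvar l) = [:0, 1:]" "\<nexists>c. c \<noteq> 0 \<and> h p = [:c:]"
proof -
  \<comment> \<open>One more than the largest exponent in \<open>p\<close>. For \<open>p = 0\<close>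
    the maximum of the empty set is unspecified, but \<open>N\<close> is still positive.\<close>
  define N where "N = Suc (Max ((\<lambda>(m, i). Poly_Mapping.lookup m i) ` (Poly_Mapping.keys p \<times> UNIV)))"
  let ?W = "\<lambda>(w::'n \<Rightarrow> nat) m. \<Sum>i\<in>UNIV. Poly_Mapping.lookup m i * w i"
  have lt: "Poly_Mapping.lookup m i < N" if "m \<in> Poly_Mapping.keys p" for m i
    unfolding N_def less_Suc_eq_le using that by (intro Max_ge) force+
  have "insert l (UNIV - {l}) = UNIV" by auto
  moreover have "0 < N" by (simp add: N_def)
  ultimately  obtain w where w: "\<And>i. 0 < w i" "w l = 1"
    and inj: "\<And>a b. (\<forall>i. a i < N) \<Longrightarrow> (\<forall>i. b i < N) \<Longrightarrow>
     (\<Sum>i\<in>UNIV. a i * w i) = (\<Sum>i\<in>UNIV. b i * w i) \<Longrightarrow> (\<forall>i. a i = b i)"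
    using exists_separating_weights[of "UNIV - {l}" l N]
    by (auto simp del: One_nat_def) meson
  let ?h = "insertion (\<lambda>c::'k. [:c:]) (\<lambda>i::'n. monom 1 (w i))"
  have hom: "alg_hom (\<lambda>c. [:c:]) ?h"
    by (rule alg_hom_insertion) (simp_all add: one_pCons)
  have l: "?h (pvar l) = [:0, 1:]"
    by (subst insertion_pvar) (simp_all add: one_pCons w monom_Suc monom_0)
  have prod: "(\<Prod>i\<in>UNIV. monom 1 (w i) ^ Poly_Mapping.lookup m i) = monom (1::'k) (?W w m)" for m
  proof -
    have "(\<Prod>i\<in>S. monom 1 (w i) ^ Poly_Mapping.lookup m i) =
        monom (1::'k) (\<Sum>i\<in>S. Poly_Mapping.lookup m i * w i)" for S
      by (induction S rule: infinite_finite_induct) (auto simp: monom_power mult_monom mult.commute)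
    then show ?thesis .
  qed
  have "\<nexists>c. c \<noteq> 0 \<and> ?h p = [:c:]"
  proof (cases "p = 0")
    case True
    then show ?thesis using alg_hom_0[OF hom] by simp
  next
    case False
    have "\<exists>m\<in>Poly_Mapping.keys p. m \<noteq> 0"
    proof (rule ccontr)
      assume "\<not> ?thesis"
      then have "Poly_Mapping.keys p \<subseteq> {0}" by auto
      then have "Poly_Mapping.keys p = {0}" using False by (simp add: subset_singleton_iff)
      then have "p = pconst (Poly_Mapping.lookup p 0)" "Poly_Mapping.lookup p 0 \<noteq> 0"
        using poly_mapping_eq_sum_single[of p] by (auto simp: pconst_def in_keys_iff)
      then show False using assms by blast
    qed
    then obtain m where m: "m \<in> Poly_Mapping.keys p" "m \<noteq> 0" by blast
    have "coeff (?h p) (?W w m) = (\<Sum>k\<in>Poly_Mapping.keys p. if k = m then Poly_Mapping.lookup p k else 0)"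
      unfolding insertion_def prod coeff_sum
    proof (rule sum.cong)
      fix k assume k: "k \<in> Poly_Mapping.keys p"
      have "k = m" if "?W w k = ?W w m"
        using inj[of "Poly_Mapping.lookup k" "Poly_Mapping.lookup m"] that lt k m(1)
        by (auto intro: poly_mapping_eqI)
      then show "coeff ([:Poly_Mapping.lookup p k:] * monom 1 (?W w k)) (?W w m) =
          (if k = m then Poly_Mapping.lookup p k else 0)"
        by auto
    qed simp
    also have "\<dots> \<noteq> 0" using m by (simp add: in_keys_iff)
    finally have "coeff (?h p) (?W w m) \<noteq> 0" .
    \<comment> \<open>Positive weights give a nonzero exponent vector a positive degree in
      \<open>X\<close>.\<close>
    moreover have "?W w m \<noteq> 0"
    proof
      assume "?W w m = 0"
      then have "Poly_Mapping.lookup m i = 0" for i using w(1)[of i] by auto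
      then show False using m(2) by (auto intro: poly_mapping_eqI)
    qed
    moreover have "coeff [:c::'k:] k = 0" if "k \<noteq> 0" for c k using that by (cases k) simp_all
    ultimately show ?thesis by metis
  qed
  with hom l show ?thesis by (rule that)
qed

subsection \<open>Tame coordinates with prescribed gradient\<close>

text \<open>Termwise antiderivative; characteristic zero enters here, through the division by
  \<open>Suc i\<close>.\<close>

lemma exists_pderiv_eq:
  fixes q :: "'k::field_char_0 poly"
  shows "\<exists>G. pderiv G = q"
proof -
  have pderiv_sum: "pderiv (\<Sum>i\<in>S. g i) = (\<Sum>i\<in>S. pderiv (g i))" for g :: "nat \<Rightarrow> 'k poly" and S
    by (induction S rule: infinite_finite_induct) (auto simp: pderiv_add)
  have "pderiv (\<Sum>i\<le>degree q. monom (coeff q i / of_nat (Suc i)) (Suc i)) =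
      (\<Sum>i\<le>degree q. monom (coeff q i) i)"
    unfolding pderiv_sum pderiv_monom by (intro sum.cong) (simp_all del: of_nat_Suc)
  then show ?thesis by (metis poly_as_sum_of_monoms)
qed

lemma free_of_0: "free_of i 0"
  by (simp add: free_of_def)

lemma free_of_pconst: "free_of i (pconst c)"
  by (auto simp: free_of_def pconst_def)

lemma free_of_pvar: "i \<noteq> j \<Longrightarrow> free_of i (pvar j)"
  by (auto simp: free_of_def pvar_def lookup_single)

lemma free_of_add: "free_of i p \<Longrightarrow> free_of i q \<Longrightarrow> free_of i (p + q)"
  using Poly_Mapping.keys_add[of p q] by (auto simp: free_of_def)

lemma free_of_uminus: "free_of i p \<Longrightarrow> free_of i (- p)"
  for p :: "('n, 'k::ab_group_add) mpoly"
  by (simp add: free_of_def)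

lemma free_of_mult: "free_of i p \<Longrightarrow> free_of i q \<Longrightarrow> free_of i (p * q)"
  for p q :: "('n, 'k::comm_semiring_1) mpoly"
  using keys_mult[of p q] by (fastforce simp: free_of_def lookup_add)

lemma free_of_sum: "(\<And>j. j \<in> S \<Longrightarrow> free_of i (g j)) \<Longrightarrow> free_of i (\<Sum>j\<in>S. g j)"
  by (induction S rule: infinite_finite_induct) (auto simp: free_of_0 free_of_add)

text \<open>The substitution \<open>E F\<close> is elementary with inverse \<open>E (- F)\<close>,
  because both fix \<open>F\<close>.\<close>

lemma tame_coordinate_pvar_add:
  fixes F :: "('n::finite, 'k::field) mpoly"
  assumes F: "free_of i F"
  shows "tame_coordinate (pvar i + F)"
proof -
  define E :: "('n, 'k) mpoly \<Rightarrow> ('n, 'k) mpoly \<Rightarrow> ('n, 'k) mpoly"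
    where "E v = insertion pconst (pvar(i := pvar i + v))" for v
  have hom: "alg_hom pconst (E v)" for v
    unfolding E_def by (rule alg_hom_pinsertion)
  have var: "E v (pvar j) = (if j = i then pvar i + v else pvar j)" for v j
    unfolding E_def by (simp add: pinsertion_pvar)
  have idh: "alg_hom pconst (\<lambda>p::('n, 'k) mpoly. p)" by (simp add: alg_hom_def)
  have fixF: "E v w = w" if "free_of i w" for v w
  proof -
    have "E v w = insertion pconst pvar w"
      unfolding E_def using that by (rule insertion_cong_free_of) auto
    also have "\<dots> = w"
      by (rule alg_hom_ext[OF alg_hom_pinsertion idh]) (simp add: pinsertion_pvar)
    finally show ?thesis .
  qed
  have inv: "E v (E (- v) p) = p" if v: "free_of i v" for v p
  proof -
    have "(E v \<circ> E (- v)) p = p"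
    proof (rule alg_hom_ext[OF _ idh])
      show "alg_hom pconst (E v \<circ> E (- v))"
        by (rule alg_hom_comp) (simp_all add: hom k_endomorphism_iff_alg_hom)
      show "(E v \<circ> E (- v)) (pvar j) = pvar j" for j
        by (simp add: var alg_hom_simps[OF hom] fixF[OF v])
    qed
    then show ?thesis by simp
  qed
  have "bij (E F)"
    by (rule o_bij[of "E (- F)"])
      (use inv[of "- F"] inv[of F] F in \<open>auto simp: fun_eq_iff free_of_uminus\<close>)
  then have "elementary_automorphism (E F)"
    unfolding elementary_automorphism_def k_automorphism_def
    using F hom by (auto simp: k_endomorphism_iff_alg_hom var intro!: exI[of _ i] exI[of _ 1] exI[of _ F])
  then show ?thesis
    unfolding tame_coordinate_def
    by (intro exI[of _ "E F"] exI[of _ i]) (simp add: var tame_automorphism.elementary)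
qed

lemma tame_coordinate_pvar: "tame_coordinate (pvar i :: ('n::finite, 'k::field) mpoly)"
  using tame_coordinate_pvar_add[OF free_of_0, of i] by simp

definition poly_in :: "'n \<Rightarrow> 'k::field poly \<Rightarrow> ('n, 'k) mpoly" where
  "poly_in i q = poly (map_poly pconst q) (pvar i)"

lemma poly_in_0 [simp]: "poly_in i 0 = 0"
  by (simp add: poly_in_def)

lemma poly_in_pCons: "poly_in i (pCons a q) = pconst a + pvar i * poly_in i q"
  by (simp add: poly_in_def map_poly_pCons)

lemma poly_in_add: "poly_in i (p + q) = poly_in i p + poly_in i q"
proof (induction p q rule: poly_induct2)
  case (pCons a p b q)
  then show ?case by (simp add: poly_in_pCons pconst_add algebra_simps)
qed simp

text \<open>Every element of \<open>k[X]\<close>, hence of the residue field, is thus the value of a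
  polynomial in the single variable \<open>i\<close>.\<close>

lemma alg_hom_poly_in:
  assumes "alg_hom (\<lambda>c. [:c:]) g" "g (pvar i) = [:0, 1:]"
  shows "g (poly_in i q) = q"
  by (induction q) (auto simp: poly_in_pCons alg_hom_simps[OF assms(1)] assms(2))

lemma pderiv_wrt_poly_in:
  "pderiv_wrt j (poly_in i q) = (if j = i then poly_in i (pderiv q) else 0)"
  by (induction q) (auto simp: poly_in_pCons pderiv_pCons poly_in_add pderiv_wrt_add
      pderiv_wrt_mult pderiv_wrt_pvar)

lemma free_of_poly_in: "i \<noteq> j \<Longrightarrow> free_of i (poly_in j q)"
  by (induction q) (auto simp: poly_in_pCons free_of_0 free_of_add free_of_mult free_of_pconst free_of_pvar)

text \<open>Each \<open>c i\<close> can be lifted to a polynomial in the variable \<open>i0\<close>,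
  so one elementary automorphism realises all entries at once; its coefficient 1 at another variable
  \<open>i1\<close> forces the factor \<open>d\<close>.\<close>

lemma exists_tame_coordinate_with_gradient:
  fixes g :: "('n::finite, 'k::field_char_0) mpoly \<Rightarrow> 'k poly"
  assumes g: "alg_hom (\<lambda>c. [:c:]) g" and g0: "g (pvar i0) = [:0, 1:]"
    and inverse_mod: "\<forall>a. \<not> m dvd a \<longrightarrow> (\<exists>b. m dvd a * b - 1)"
    and c: "\<exists>i. \<not> m dvd c i"
  shows "\<exists>p d. tame_coordinate p \<and> (\<forall>i. m dvd g (pderiv_wrt i p) - d * c i)"
proof (cases "\<exists>i1. i1 \<noteq> i0 \<and> \<not> m dvd c i1")
  case True
  then obtain i1 d where i1: "i1 \<noteq> i0" and d: "m dvd c i1 * d - 1"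
    using inverse_mod by blast
  \<comment> \<open>\<open>i1\<close> gets the coefficient 1 and \<open>i0\<close> is served by
    \<open>G\<close>, so the linear terms run over the rest.\<close>
  define S where "S = UNIV - {i0, i1}"
  define c' where "c' i = d * c i" for i
  \<comment> \<open>\<open>G\<close> corrects the derivative by \<open>i0\<close>, the only one in which the coefficients \<open>c' i\<close> get differentiated.\<close>
  obtain G where G: "pderiv G = c' i0 - (\<Sum>i\<in>S. pderiv (c' i) * g (pvar i))"
    using exists_pderiv_eq by blast
  define F where "F = (\<Sum>i\<in>S. poly_in i0 (c' i) * pvar i) + poly_in i0 G"
  have "free_of i1 F"
    unfolding F_def using i1
    by (intro free_of_add free_of_sum free_of_mult free_of_poly_in free_of_pvar) (auto simp: S_def)
  then have "tame_coordinate (pvar i1 + F)" by (rule tame_coordinate_pvar_add)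
  moreover have "m dvd g (pderiv_wrt k (pvar i1 + F)) - d * c k" for k
  proof -
    \<comment> \<open>By the product rule a summand contributes its coefficient at
      \<open>k = i\<close> and, at \<open>k = i0\<close> only, the derivative of that coefficient.
      The latter terms cancel against \<open>pderiv G\<close>, leaving \<open>c' i0\<close>.\<close>
    have "g (pderiv_wrt k F) = (\<Sum>i\<in>S. (if k = i0 then pderiv (c' i) * g (pvar i) else 0) +
        (if i = k then c' i else 0)) + (if k = i0 then pderiv G else 0)"
      unfolding F_def pderiv_wrt_add pderiv_wrt_sum pderiv_wrt_mult pderiv_wrt_poly_in pderiv_wrt_pvar
        alg_hom_add[OF g] alg_hom_sum[OF g]
      by (intro arg_cong2[of _ _ _ _ "(+)"] sum.cong)
        (auto simp: alg_hom_simps[OF g] alg_hom_poly_in[OF g g0])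
    also have "\<dots> = (if k = i1 then 0 else c' k)"
      using i1 by (auto simp: sum.distrib G S_def)
    finally have "g (pderiv_wrt k (pvar i1 + F)) = (if k = i1 then 1 else c' k)"
      by (auto simp: pderiv_wrt_add pderiv_wrt_pvar alg_hom_simps[OF g])
    moreover have "m dvd 1 - d * c i1" using d by (metis dvd_diff_commute mult.commute)
    ultimately show ?thesis by (auto simp: c'_def)
  qed
  ultimately show ?thesis by (intro exI[of _ "pvar i1 + F"] exI[of _ d] conjI allI)
next
  case False
  \<comment> \<open>Modulo \<open>m\<close> the vector is supported at \<open>i0\<close>, so the
    variable itself has a proportional gradient.\<close>
  then have dvd: "\<And>i. i \<noteq> i0 \<Longrightarrow> m dvd c i" and "\<not> m dvd c i0" using c by (blast, metis)
  then obtain d where "m dvd c i0 * d - 1" using inverse_mod by blast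
  then have d: "m dvd 1 - d * c i0" by (metis dvd_diff_commute mult.commute)
  have "m dvd g (pderiv_wrt i (pvar i0)) - d * c i" for i
    using d dvd[of i] by (cases "i = i0") (auto simp: pderiv_wrt_pvar alg_hom_simps[OF g])
  with tame_coordinate_pvar show ?thesis by (intro exI[of _ "pvar i0"] exI[of _ d] conjI allI)
qed

section \<open>Contradiction at a point where the Jacobian determinant vanishes\<close>

theorem theorem1p2:
  fixes \<phi> :: "('n::finite, 'k::field_char_0) mpoly \<Rightarrow> ('n, 'k) mpoly"
    and f :: "'n \<Rightarrow> ('n, 'k) mpoly"
  assumes "k_endomorphism \<phi>"
    and "\<And>i. \<phi> (pvar i) = f i"
    and "\<And>p. tame_coordinate p \<Longrightarrow> coordinate (\<phi> p)"
  shows "\<exists>c::'k. c \<noteq> 0 \<and> jacobian_det f = pconst c"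
proof (rule ccontr)
  assume nonconst: "\<not> ?thesis"
  let ?J = "jacobian_det f"
  \<comment> \<open>Any variable serves; there is one because types are inhabited.\<close>
  obtain i0 :: 'n where True by blast
  obtain \<psi> l where \<psi>: "k_automorphism \<psi>" and f0: "f i0 = \<psi> (pvar l)"
    using assms(3)[OF tame_coordinate_pvar[of i0]] by (auto simp: assms(2) coordinate_def)
  note inv = k_endomorphism_inv[OF \<psi>]
  have nonconst': "\<nexists>c. c \<noteq> 0 \<and> inv \<psi> ?J = pconst c"
  proof safe
    fix c :: 'k assume "c \<noteq> 0" "inv \<psi> ?J = pconst c"
    then have "?J = pconst c" "c \<noteq> 0"
      using inv(3)[of ?J] \<psi> by (auto simp: k_automorphism_def k_endomorphism_def)
    then show False using nonconst by blast
  qed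
  \<comment> \<open>The index \<open>l\<close> is the one with
    \<open>\<psi> (pvar l) = f i0\<close>, whence \<open>h (f i0)\<close> will be \<open>X\<close>
    itself.\<close>
  obtain ev where ev: "alg_hom (\<lambda>c. [:c:]) ev" "ev (pvar l) = [:0, 1:]"
    "\<nexists>c. c \<noteq> 0 \<and> ev (inv \<psi> ?J) = [:c:]"
    by (rule exists_alg_hom_nonconst[OF nonconst'])
  define h where "h = ev \<circ> inv \<psi>"
  have h: "alg_hom (\<lambda>c. [:c:]) h" unfolding h_def using inv(1) ev(1) by (rule alg_hom_comp)
  have h\<phi>: "alg_hom (\<lambda>c. [:c:]) (h \<circ> \<phi>)" using assms(1) h by (rule alg_hom_comp)
  have h\<phi>0: "(h \<circ> \<phi>) (pvar i0) = [:0, 1:]" by (simp add: h_def assms(2) f0 inv ev)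
  have "\<nexists>c. c \<noteq> 0 \<and> h ?J = [:c:]" using ev(3) by (simp add: h_def)
  \<comment> \<open>Reducing \<open>h\<close> modulo \<open>m\<close> gives a point over the field
    \<open>k[X]/(m)\<close> at which the Jacobian determinant vanishes.\<close>
  from exists_residue_field_divisor[OF this] obtain m where
    m: "\<not> m dvd 1" "m dvd h ?J" "\<forall>a. \<not> m dvd a \<longrightarrow> (\<exists>b. m dvd a * b - 1)"
    by (elim exE conjE)
  have dvd_det: "m dvd det (\<chi> i j. h (pderiv_wrt j (f i)))"
    using m(2) by (simp add: jacobian_det_def alg_hom_det[OF h])
  obtain c where c: "\<exists>i. \<not> m dvd c i" "\<And>j. m dvd (\<Sum>i\<in>UNIV. c i * h (pderiv_wrt j (f i)))"
    by (rule row_dependence_mod_of_dvd_det[OF m(3,1) dvd_det]) simp_all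
  \<comment> \<open>The gradient is prescribed along \<open>h \<circ> \<phi>\<close>, that is, at
    the image of the point under \<open>\<phi>\<close>, where the variable \<open>i0\<close> takes
    the value \<open>X\<close>.\<close>
  from exists_tame_coordinate_with_gradient[OF h\<phi> h\<phi>0 m(3) c(1)]
  obtain p d where p: "tame_coordinate p" "\<forall>i. m dvd (h \<circ> \<phi>) (pderiv_wrt i p) - d * c i"
    by (elim exE conjE)
  have gradient: "m dvd h (pderiv_wrt j (\<phi> p))" for j
  proof -
    let ?a = "\<lambda>i. (h \<circ> \<phi>) (pderiv_wrt i p)" and ?b = "\<lambda>i. h (pderiv_wrt j (f i))"
    have "h (pderiv_wrt j (\<phi> p)) = (\<Sum>i\<in>UNIV. ?a i * ?b i)"
      by (simp only: pderiv_wrt_k_endomorphism[OF assms(1), of j p] assms(2) alg_hom_sum[OF h]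
          alg_hom_mult[OF h] comp_apply)
    \<comment> \<open>Modulo \<open>m\<close> the gradient of \<open>p\<close> is \<open>d\<close>
      times \<open>c\<close>, and \<open>c\<close> lies in the left kernel of the Jacobian
      matrix.\<close>
    also have "\<dots> = (\<Sum>i\<in>UNIV. (?a i - d * c i) * ?b i) + d * (\<Sum>i\<in>UNIV. c i * ?b i)"
      by (simp add: left_diff_distrib sum_subtractf sum_distrib_left mult.assoc)
    also have "m dvd \<dots>"
      by (intro dvd_add dvd_sum dvd_mult2[OF p(2)[rule_format]] dvd_mult c(2))
    finally show ?thesis .
  qed
  \<comment> \<open>As \<open>\<phi> p\<close> is a coordinate, some combination of its partial
    derivatives is 1, yet \<open>m\<close> divides the image of each under \<open>h\<close>.\<close>
  obtain w where "(\<Sum>j\<in>UNIV. pderiv_wrt j (\<phi> p) * w j) = 1"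
    using coordinate_pderiv_unimodular[OF assms(3)[OF p(1)]] .
  then have "h (\<Sum>j\<in>UNIV. pderiv_wrt j (\<phi> p) * w j) = 1" by (simp only: alg_hom_1[OF h])
  then have "(\<Sum>j\<in>UNIV. h (pderiv_wrt j (\<phi> p)) * h (w j)) = 1"
    by (simp only: alg_hom_sum[OF h] alg_hom_mult[OF h])
  moreover have "m dvd (\<Sum>j\<in>UNIV. h (pderiv_wrt j (\<phi> p)) * h (w j))"
    by (intro dvd_sum dvd_mult2 gradient)
  ultimately show False using m(1) by simp
qed

end
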